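(* Let $d\ge1$. For every finite response history $H^0$ in dimension $d$ and every slope $\ell\ge0$, the escape game from $H^0$ at slope $\ell$ is determined: exactly one of the following holds. (i) The adversary wins from $H^0$ for $\operatorname{Esc}_{\ell,H^0}$, i.e. there exists an adversary strategy $\sigma$ such that for every controller strategy $\mu$ the resulting play from $H^0$ belongs to $\operatorname{Esc}_{\ell,H^0}$. (ii) The controller wins from $H^0$ against $\operatorname{Esc}_{\ell,H^0}$, i.e. there exists a controller strategy $\mu$ such that for every adversary strategy $\sigma$ the resulting play from $H^0$ does not belong to $\operatorname{Esc}_{\ell,H^0}$.
   Context: $\|\cdot\|$ is the Euclidean norm on $\mathbb{R}^d$. A finite response history of length $n\ge0$ is $H=(x_0,\dots,x_n;r_0,\dots,r_{n-1})$ with all $x_i,r_i\in\mathbb{R}^d$ (no responses if $n=0$). Its state radius is $\operatorname{rad}(H)=\max_{0\le i\le n}\|x_i-x_0\|$. For $u,r\in\mathbb{R}^d$ the successor history is $H^+(u,r)=(x_0,\dots,x_n,u+r;r_0,\dots,r_{n-1},r)$. For $\ell\ge0$, $\operatorname{Env}_\ell(H)=0$ if $n=0$, and $\operatorname{Env}_\ell(H)=\max_{0\le i,j\le n-1}(\|r_i-r_j\|-\ell\|x_i-x_j\|)_+$ if $n\ge1$, where $q_+=\max\{q,0\}$. A play from an initial history $H^0$ is a sequence $\pi=(H^k,u_k,r_k,H^{k+1})_{k\ge0}$ with $u_k,r_k\in\mathbb{R}^d$ and $H^{k+1}=(H^k)^+(u_k,r_k)$. At stage $k$ the controller sees $H^k$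 and chooses $u_k$; then the adversary sees $(H^k,u_k)$ and chooses $r_k$. A controller strategy is an arbitrary map $\mu$ (no measurability required) from finite response histories to $\mathbb{R}^d$ ($u_k=\mu(H^k)$); an adversary strategy is an arbitrary map $\sigma$ from pairs $(H,u)$ to $\mathbb{R}^d$ ($r_k=\sigma(H^k,u_k)$). A pair of strategies and an initial history determine a unique play. Let $\operatorname{Env}^\infty_\ell(\pi)=\sup_k\operatorname{Env}_\ell(H^k)$, and let $\operatorname{Esc}_{\ell,H^0}$ be the set of plays $\pi$ from $H^0$ with $\operatorname{Env}^\infty_\ell(\pi)<\infty$ and $\sup_k\operatorname{rad}(H^k)=\infty$. *)

theory Defs
  imports "HOL-Analysis.Analysis"
begin

text \<open>Euclidean space of dimension \<open>d\<close> is \<^typ>\<open>real ^ 'd\<close> with \<open>d = CARD('d)\<close>, which is at least 1.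
  A history of length \<open>n\<close> is a pair of a list of \<open>n + 1\<close> states and a list of \<open>n\<close> responses.\<close>

typedef 'd history =
  "{(xs :: (real ^ 'd::finite) list, rs :: (real ^ 'd) list). length xs = Suc (length rs)}"
  by (rule exI[of _ "([0], [])"]) simp

setup_lifting type_definition_history

lift_definition states :: "'d::finite history \<Rightarrow> (real ^ 'd) list" is fst .

lift_definition responses :: "'d::finite history \<Rightarrow> (real ^ 'd) list" is snd .

definition hlen :: "'d::finite history \<Rightarrow> nat" where
  "hlen H = length (responses H)"

lemma length_states: "length (states H) = Suc (hlen H)"
  unfolding hlen_def by transfer auto

lift_definition succ_history :: "'d::finite history \<Rightarrow> real ^ 'd \<Rightarrow> real ^ 'd \<Rightarrow> 'd history"
  is "\<lambda>(xs, rs) u r. (xs @ [u + r], rs @ [r])"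
  by auto

lemma states_succ_history: "states (succ_history H u r) = states H @ [u + r]"
  by transfer auto

lemma responses_succ_history: "responses (succ_history H u r) = responses H @ [r]"
  by transfer auto

definition rad :: "'d::finite history \<Rightarrow> real" where
  "rad H = Max ((\<lambda>i. norm (states H ! i - states H ! 0)) ` {0..hlen H})"

definition Env :: "real \<Rightarrow> 'd::finite history \<Rightarrow> real" where
  "Env l H =
    (if hlen H = 0 then 0
     else Max ((\<lambda>(i, j). max (norm (responses H ! i - responses H ! j)
                              - l * norm (states H ! i - states H ! j)) 0)
               ` ({0..<hlen H} \<times> {0..<hlen H})))"

type_synonym 'd play = "nat \<Rightarrow> 'd history \<times> (real ^ 'd) \<times> (real ^ 'd) \<times> 'd history"

definition hist :: "'d::finite play \<Rightarrow> nat \<Rightarrow> 'd history" where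
  "hist \<pi> k = fst (\<pi> k)"

definition plays :: "'d::finite history \<Rightarrow> 'd play set" where
  "plays H0 = {\<pi>. hist \<pi> 0 = H0 \<and>
     (\<forall>k. \<exists>u r. \<pi> k = (hist \<pi> k, u, r, hist \<pi> (Suc k)) \<and>
                hist \<pi> (Suc k) = succ_history (hist \<pi> k) u r)}"

type_synonym 'd controller = "'d history \<Rightarrow> real ^ 'd"

type_synonym 'd adversary = "'d history \<times> (real ^ 'd) \<Rightarrow> real ^ 'd"

fun round_of :: "'d::finite controller \<Rightarrow> 'd adversary \<Rightarrow> 'd history
    \<Rightarrow> 'd history \<times> (real ^ 'd) \<times> (real ^ 'd) \<times> 'd history" where
  "round_of \<mu> \<sigma> H = (let u = \<mu> H; r = \<sigma> (H, u) in (H, u, r, succ_history H u r))"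

primrec play_of :: "'d::finite controller \<Rightarrow> 'd adversary \<Rightarrow> 'd history \<Rightarrow> 'd play" where
  "play_of \<mu> \<sigma> H0 0 = round_of \<mu> \<sigma> H0"
| "play_of \<mu> \<sigma> H0 (Suc k) = round_of \<mu> \<sigma> (snd (snd (snd (play_of \<mu> \<sigma> H0 k))))"

lemma play_of_in_plays: "play_of \<mu> \<sigma> H0 \<in> plays H0"
proof -
  have "\<exists>u r. play_of \<mu> \<sigma> H0 k = (hist (play_of \<mu> \<sigma> H0) k, u, r, hist (play_of \<mu> \<sigma> H0) (Suc k)) \<and>
      hist (play_of \<mu> \<sigma> H0) (Suc k) = succ_history (hist (play_of \<mu> \<sigma> H0) k) u r" for k
    by (cases k) (simp_all add: hist_def Let_def)
  then show ?thesis
    by (simp add: plays_def hist_def Let_def)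
qed

definition Env_inf :: "real \<Rightarrow> 'd::finite play \<Rightarrow> ereal" where
  "Env_inf l \<pi> = (SUP k. ereal (Env l (hist \<pi> k)))"

definition Esc :: "real \<Rightarrow> 'd::finite history \<Rightarrow> 'd play set" where
  "Esc l H0 = {\<pi> \<in> plays H0. Env_inf l \<pi> < \<infinity> \<and> (SUP k. ereal (rad (hist \<pi> k))) = \<infinity>}"

definition adversary_wins :: "'d::finite history \<Rightarrow> 'd play set \<Rightarrow> bool" where
  "adversary_wins H0 W \<longleftrightarrow> (\<exists>\<sigma>. \<forall>\<mu>. play_of \<mu> \<sigma> H0 \<in> W)"

definition controller_wins :: "'d::finite history \<Rightarrow> 'd play set \<Rightarrow> bool" where
  "controller_wins H0 W \<longleftrightarrow> (\<exists>\<mu>. \<forall>\<sigma>. play_of \<mu> \<sigma> H0 \<notin> W)"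

end

theory Submission
  imports Defs
begin

text \<open>The winning condition says that an integer-valued quantity \<open>e\<close> (the floor of the envelope),
  nondecreasing along every play, stays bounded while another one \<open>r\<close> (the floor of the radius) is
  unbounded. Let \<open>W\<close> be the set of positions from which the adversary wins. For a bound \<open>M\<close> consider
  the auxiliary game in which the adversary must reach \<open>W\<close>, or keep \<open>e \<le> M\<close> forever with \<open>r\<close>
  unbounded. The adversary cannot win it from outside \<open>W\<close>. As it is a Buechi game, the controller
  wins it; he starts it with \<open>M = e(p)\<close> at the current position \<open>p\<close> and restarts it whenever \<open>e\<close>
  exceeds \<open>M\<close>. Either he restarts infinitely often and \<open>e\<close> is unbounded, or \<open>r\<close> is bounded.

  The Buechi game is treated by the same idea one level down. Outside the region \<open>V\<close> where the
  controller wins it, for each \<open>N\<close> the adversary can force a position in \<open>W\<close>, or one outside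
  \<open>V\<close> with \<open>r > N\<close> and \<open>e \<le> M\<close>, by determinacy of reachability games, and he repeats this forever.\<close>

section \<open>Forcing in trees\<close>

text \<open>A player is represented by an effectivity function: \<open>E p\<close> is the family of those sets of
  successors of \<open>p\<close> to which the player can confine the next position. Both players are then
  treated alike.\<close>

definition run_of :: "('p \<Rightarrow> 'p set) \<Rightarrow> 'p \<Rightarrow> (nat \<Rightarrow> 'p) \<Rightarrow> bool" where
  "run_of s p \<rho> \<longleftrightarrow> \<rho> 0 = p \<and> (\<forall>k. \<rho> (Suc k) \<in> s (\<rho> k))"

definition force :: "('p \<Rightarrow> 'p set set) \<Rightarrow> 'p \<Rightarrow> ((nat \<Rightarrow> 'p) \<Rightarrow> bool) \<Rightarrow> bool" where
  "force E p \<Phi> \<longleftrightarrow> (\<exists>s. (\<forall>q. s q \<in> E q) \<and> (\<forall>\<rho>. run_of s p \<rho> \<longrightarrow> \<Phi> \<rho>))"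

lemma force_mono:
  assumes "force E p \<Phi>" "\<And>\<rho>. \<Phi> \<rho> \<Longrightarrow> \<Psi> \<rho>"
  shows "force E p \<Psi>"
proof -
  obtain s where s: "\<forall>q. s q \<in> E q" "\<And>\<rho>. run_of s p \<rho> \<Longrightarrow> \<Phi> \<rho>"
    using assms(1) unfolding force_def by blast
  then have "\<Psi> \<rho>" if "run_of s p \<rho>" for \<rho>
    using assms(2) that by blast
  with s(1) show ?thesis
    unfolding force_def by blast
qed

text \<open>Positions form a tree: \<open>par\<close> recovers the predecessor, \<open>len\<close>
  the depth. Nonemptiness ensures that strategies exist and finite plays can be prolonged.\<close>

locale arena =
  fixes E :: "'p \<Rightarrow> 'p set set" and par :: "'p \<Rightarrow> 'p" and len :: "'p \<Rightarrow> nat"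
  assumes E_nonempty: "E p \<noteq> {}"
    and move_nonempty: "X \<in> E p \<Longrightarrow> X \<noteq> {}"
    and par_move: "X \<in> E p \<Longrightarrow> q \<in> X \<Longrightarrow> par q = p"
    and len_move: "X \<in> E p \<Longrightarrow> q \<in> X \<Longrightarrow> len q = Suc (len p)"
begin

text \<open>The memory is recomputed from the current position by walking \<open>n\<close> steps
  back along \<open>par\<close>; \<open>init\<close> is its value there.\<close>

primrec memory :: "'m \<Rightarrow> ('m \<Rightarrow> 'p \<Rightarrow> 'm) \<Rightarrow> nat \<Rightarrow> 'p \<Rightarrow> 'm" where
  "memory init upd 0 p = init"
| "memory init upd (Suc n) p = upd (memory init upd n (par p)) p"

definition memory_run ::
    "('m \<Rightarrow> 'p \<Rightarrow> 'p set) \<Rightarrow> ('m \<Rightarrow> 'p \<Rightarrow> 'm) \<Rightarrow> 'm \<Rightarrow> 'p \<Rightarrow> (nat \<Rightarrow> 'p) \<Rightarrow> (nat \<Rightarrow> 'm) \<Rightarrow> bool" where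
  "memory_run nxt upd init p \<rho> \<mu> \<longleftrightarrow> \<rho> 0 = p \<and> \<mu> 0 = init \<and>
    (\<forall>k. \<rho> (Suc k) \<in> nxt (\<mu> k) (\<rho> k)) \<and> (\<forall>k. \<mu> (Suc k) = upd (\<mu> k) (\<rho> (Suc k)))"

text \<open>In a tree a position determines the play that led to it, so strategies with memory
  need no separate treatment.\<close>

lemma force_memory:
  assumes move: "\<And>m q. nxt m q \<in> E q"
    and win: "\<And>\<rho> \<mu>. memory_run nxt upd init p \<rho> \<mu> \<Longrightarrow> \<Phi> \<rho>"
  shows "force E p \<Phi>"
proof -
  \<comment> \<open>\<open>len q - len p\<close> counts the rounds since \<open>p\<close>. Away from
    the descendants of \<open>p\<close> the memory value is meaningless, but the move is still
    legal.\<close>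
  define s where "s q = nxt (memory init upd (len q - len p) q) q" for q
  have s: "s q \<in> E q" for q
    by (simp add: s_def move)
  have "\<Phi> \<rho>" if run: "run_of s p \<rho>" for \<rho>
  proof -
    have \<rho>: "\<rho> 0 = p" "\<And>k. \<rho> (Suc k) \<in> s (\<rho> k)"
      using run by (auto simp: run_of_def)
    have par: "par (\<rho> (Suc k)) = \<rho> k" for k
      using par_move[OF s \<rho>(2)] .
    have len: "len (\<rho> k) = len p + k" for k
      by (induction k) (auto simp: \<rho>(1) len_move[OF s \<rho>(2)])
    have "\<rho> (Suc k) \<in> nxt (memory init upd k (\<rho> k)) (\<rho> k)" for k
      using \<rho>(2)[of k] by (simp add: s_def len)
    then have "memory_run nxt upd init p \<rho> (\<lambda>k. memory init upd k (\<rho> k))"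
      by (simp add: memory_run_def \<rho>(1) par)
    then show ?thesis
      by (rule win)
  qed
  with s show ?thesis
    unfolding force_def by blast
qed

section \<open>Prolonging, switching and restarting strategies\<close>

lemma strategy_extending:
  assumes "X \<in> E p"
  obtains s where "\<forall>q. s q \<in> E q" "s p = X"
proof
  show "\<forall>q. ((\<lambda>q. SOME Y. Y \<in> E q)(p := X)) q \<in> E q"
    using assms some_in_eq[of "E _"] E_nonempty by auto
qed simp

text \<open>Winning strategies only speak about infinite runs, so a finite play must be prolonged
  before their guarantee applies to it.\<close>

lemma extend_finite_run:
  assumes s: "\<forall>q. s q \<in> E q" and step: "\<And>i. i < k \<Longrightarrow> \<rho> (Suc i) \<in> s (\<rho> i)"
  obtains \<rho>' where "run_of s (\<rho> 0) \<rho>'" "\<forall>i\<le>k. \<rho>' i = \<rho> i"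
proof -
  define c where "c = (\<lambda>n. (\<lambda>q. SOME q'. q' \<in> s q) ^^ n)"
  define \<rho>' where "\<rho>' i = (if i \<le> k then \<rho> i else c (i - k) (\<rho> k))" for i
  have "s q \<noteq> {}" for q
    using s move_nonempty by blast
  then have c: "c (Suc n) q \<in> s (c n q)" for n q
    by (simp add: c_def some_in_eq)
  have "\<rho>' (Suc i) \<in> s (\<rho>' i)" for i
  proof (cases i k rule: linorder_cases)
    case less
    then show ?thesis by (simp add: \<rho>'_def step)
  next
    case equal
    then show ?thesis using c[of 0 "\<rho> k"] by (simp add: \<rho>'_def c_def)
  next
    case greater
    then show ?thesis using c[of "i - k" "\<rho> k"] by (simp add: \<rho>'_def Suc_diff_le)
  qed
  then have "run_of s (\<rho> 0) \<rho>'"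
    by (simp add: run_of_def \<rho>'_def)
  then show thesis
    by (rule that) (simp add: \<rho>'_def)
qed

text \<open>Follow a strategy for \<open>\<Phi>\<close> until the first visit to \<open>Z\<close>,
  then switch to one for \<open>\<Psi>\<close>. After a switch at time \<open>k\<close> the first
  strategy has governed only a finite segment, so \<open>\<Phi>\<close> is asserted of some run
  \<open>\<rho>'\<close> sharing that segment.\<close>

lemma force_compose:
  assumes base: "force E p \<Phi>" and cont: "\<And>q. q \<in> Z \<Longrightarrow> force E q \<Psi>"
  shows "force E p (\<lambda>\<rho>. (\<Phi> \<rho> \<and> (\<forall>k. \<rho> k \<notin> Z)) \<or>
    (\<exists>k \<rho>'. \<rho> k \<in> Z \<and> \<Psi> (\<lambda>i. \<rho> (k + i)) \<and> \<Phi> \<rho>' \<and> (\<forall>i\<le>k. \<rho>' i = \<rho> i)))"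
    (is "force E p ?G")
proof -
  obtain s where s: "\<forall>q. s q \<in> E q" "\<And>\<rho>. run_of s p \<rho> \<Longrightarrow> \<Phi> \<rho>"
    using base unfolding force_def by blast
  have "\<exists>t. (\<forall>q'. t q' \<in> E q') \<and> (q \<in> Z \<longrightarrow> (\<forall>\<rho>. run_of t q \<rho> \<longrightarrow> \<Psi> \<rho>))" for q
    using cont[of q] s(1) unfolding force_def by blast
  then obtain T where T: "\<And>q q'. T q q' \<in> E q'"
      "\<And>q \<rho>. q \<in> Z \<Longrightarrow> run_of (T q) q \<rho> \<Longrightarrow> \<Psi> \<rho>"
    by metis
  \<comment> \<open>The memory holds \<open>p\<close> before the switch and the switching position
    afterwards; membership in \<open>Z\<close> tells which.\<close>
  define S where "S m = (if m \<in> Z then T m else s)" for m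
  show ?thesis
  proof (rule force_memory)
    show "S m q \<in> E q" for m q
      using s(1) T(1) by (simp add: S_def)
    fix \<rho> \<mu>
    assume "memory_run S (\<lambda>m q. if m \<notin> Z \<and> q \<in> Z then q else m) p p \<rho> \<mu>"
    then have \<rho>0: "\<rho> 0 = p" and \<mu>0: "\<mu> 0 = p" and \<rho>: "\<And>k. \<rho> (Suc k) \<in> S (\<mu> k) (\<rho> k)"
      and \<mu>: "\<And>k. \<mu> (Suc k) = (if \<mu> k \<notin> Z \<and> \<rho> (Suc k) \<in> Z then \<rho> (Suc k) else \<mu> k)"
      by (simp_all add: memory_run_def)
    show "?G \<rho>"
    proof (cases "\<exists>k. \<rho> k \<in> Z")
      case False
      have \<mu>_notin: "\<mu> k \<notin> Z" for k
        by (induction k) (use False \<rho>0 \<mu>0 \<mu> in \<open>auto split: if_splits\<close>)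
      then have "run_of s p \<rho>"
        using \<rho> \<rho>0 by (simp add: run_of_def S_def)
      then show ?thesis
        using s(2) False by blast
    next
      case True
      define k where "k = (LEAST k. \<rho> k \<in> Z)"
      have k: "\<rho> k \<in> Z"
        unfolding k_def using True by (rule LeastI_ex)
      have before: "\<rho> i \<notin> Z" if "i < k" for i
        using that not_less_Least k_def by metis
      have \<mu>_before: "\<mu> i \<notin> Z" if "i < k" for i
        using that
      proof (induction i)
        case 0
        then show ?case using before[of 0] \<rho>0 \<mu>0 by simp
      next
        case (Suc i)
        then show ?case using before[of "Suc i"] \<mu>[of i] by simp
      qed
      have \<mu>k: "\<mu> k = \<rho> k"
      proof (cases k)
        case 0
        then show ?thesis by (simp add: \<rho>0 \<mu>0)
      next
        case (Suc j)
        then show ?thesis using \<mu>[of j] \<mu>_before[of j] k by simp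
      qed
      have \<mu>_after: "\<mu> (k + i) = \<rho> k" for i
        by (induction i) (use \<mu> \<mu>k k in auto)
      have "run_of (T (\<rho> k)) (\<rho> k) (\<lambda>i. \<rho> (k + i))"
        using \<rho>[of "k + _"] k by (simp add: run_of_def \<mu>_after S_def)
      then have "\<Psi> (\<lambda>i. \<rho> (k + i))"
        using T(2) k by blast
      moreover have "\<rho> (Suc i) \<in> s (\<rho> i)" if "i < k" for i
        using \<rho>[of i] \<mu>_before[OF that] by (simp add: S_def)
      then obtain \<rho>' where "run_of s (\<rho> 0) \<rho>'" "\<forall>i\<le>k. \<rho>' i = \<rho> i"
        using extend_finite_run[OF s(1)] by metis
      ultimately show ?thesis
        using s(2) k \<rho>0 by blast
    qed
  qed
qed

text \<open>The memory is an anchor in \<open>I\<close> whose strategy is followed. A position of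
  \<open>B\<close> with larger \<open>f\<close> becomes the new anchor, and \<open>stay\<close>
  keeps it in \<open>I\<close>. Finitely many restarts give the first alternative at the last
  anchor; infinitely many give the second, since each raises \<open>f\<close>.\<close>

lemma force_iterate:
  fixes f :: "'p \<Rightarrow> nat"
  assumes start: "p \<in> I" and phase: "\<And>q. q \<in> I \<Longrightarrow> force E q (\<Phi> q)"
    and stay: "\<And>q \<rho> k. q \<in> I \<Longrightarrow> \<Phi> q \<rho> \<Longrightarrow> \<rho> k \<in> B \<Longrightarrow> f q < f (\<rho> k) \<Longrightarrow> \<rho> k \<in> I"
  shows "force E p (\<lambda>\<rho>.
    (\<exists>k. \<rho> k \<in> I \<and> \<Phi> (\<rho> k) (\<lambda>i. \<rho> (k + i)) \<and> (\<forall>i. \<rho> (k + i) \<in> B \<longrightarrow> f (\<rho> (k + i)) \<le> f (\<rho> k))) \<or>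
    (\<forall>n. \<exists>k\<ge>n. \<rho> k \<in> B \<and> n \<le> f (\<rho> k)))" (is "force E p ?G")
proof -
  have "\<exists>t. (\<forall>q'. t q' \<in> E q') \<and> (q \<in> I \<longrightarrow> (\<forall>\<rho>. run_of t q \<rho> \<longrightarrow> \<Phi> q \<rho>))" for q
    using phase[of q] phase[OF start] unfolding force_def by blast
  then obtain S where S: "\<And>q q'. S q q' \<in> E q'"
      "\<And>q \<rho>. q \<in> I \<Longrightarrow> run_of (S q) q \<rho> \<Longrightarrow> \<Phi> q \<rho>"
    by metis
  define Q where "Q m = {q \<in> B. f m < f q}" for m
  show ?thesis
  proof (rule force_memory)
    show "S m q \<in> E q" for m q
      by (rule S(1))
    fix \<rho> \<mu>
    assume "memory_run S (\<lambda>m q. if q \<in> Q m then q else m) p p \<rho> \<mu>"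
    then have \<rho>0: "\<rho> 0 = p" and \<mu>0: "\<mu> 0 = p" and \<rho>: "\<And>k. \<rho> (Suc k) \<in> S (\<mu> k) (\<rho> k)"
      and \<mu>: "\<And>k. \<mu> (Suc k) = (if \<rho> (Suc k) \<in> Q (\<mu> k) then \<rho> (Suc k) else \<mu> k)"
      by (simp_all add: memory_run_def)
    have inv: "\<exists>j\<le>k. \<mu> k = \<rho> j \<and> \<rho> j \<in> I \<and> (\<forall>i. j \<le> i \<longrightarrow> i \<le> k \<longrightarrow> \<mu> i = \<rho> j)" for k
    proof (induction k)
      case 0
      then show ?case using \<rho>0 \<mu>0 start by auto
    next
      case (Suc k)
      then obtain j where j: "j \<le> k" "\<mu> k = \<rho> j" "\<rho> j \<in> I"
          "\<And>i. j \<le> i \<Longrightarrow> i \<le> k \<Longrightarrow> \<mu> i = \<rho> j"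
        by blast
      show ?case
      proof (cases "\<rho> (Suc k) \<in> Q (\<mu> k)")
        case False
        then have "\<mu> (Suc k) = \<rho> j"
          using \<mu>[of k] j(2) by simp
        then show ?thesis
          using j by (intro exI[of _ j]) (auto simp: le_Suc_eq)
      next
        case True
        \<comment> \<open>The segment since the anchor obeys a single strategy; its prolongation is
          a run to which \<open>stay\<close> applies.\<close>
        have "\<rho> (j + Suc i) \<in> S (\<rho> j) (\<rho> (j + i))" if "i < Suc k - j" for i
          using \<rho>[of "j + i"] j(4)[of "j + i"] that by simp
        then obtain \<rho>' where \<rho>': "run_of (S (\<rho> j)) (\<rho> (j + 0)) \<rho>'"
            "\<forall>i\<le>Suc k - j. \<rho>' i = \<rho> (j + i)"
          using extend_finite_run[of "S (\<rho> j)" "Suc k - j" "\<lambda>i. \<rho> (j + i)"] S(1) by blast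
        have "\<rho>' (Suc k - j) = \<rho> (Suc k)"
          using \<rho>'(2) j(1) by simp
        then have "\<rho> (Suc k) \<in> I"
          using stay[OF j(3), of \<rho>' "Suc k - j"] S(2)[OF j(3)] \<rho>'(1) True j(2)
          by (simp add: Q_def)
        then show ?thesis
          using True \<mu>[of k] by (intro exI[of _ "Suc k"]) (auto simp: le_antisym)
      qed
    qed
    show "?G \<rho>"
    proof (cases "\<exists>k. \<forall>i\<ge>k. \<rho> (Suc i) \<notin> Q (\<mu> i)")
      case True
      then obtain k where k: "\<And>i. k \<le> i \<Longrightarrow> \<rho> (Suc i) \<notin> Q (\<mu> i)"
        by blast
      obtain j where j: "j \<le> k" "\<rho> j \<in> I" "\<And>i. j \<le> i \<Longrightarrow> i \<le> k \<Longrightarrow> \<mu> i = \<rho> j"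
        using inv[of k] by blast
      have \<mu>_k: "\<mu> (k + i) = \<rho> j" for i
      proof (induction i)
        case (Suc i)
        then show ?case
          using \<mu>[of "k + i"] k[of "k + i"] by simp
      qed (simp add: j)
      have \<mu>_j: "\<mu> (j + i) = \<rho> j" for i
        using j(3)[of "j + i"] \<mu>_k[of "j + i - k"] by (cases "j + i \<le> k") auto
      \<comment> \<open>A later position in \<open>Q (\<rho> j)\<close> would become the anchor, but
        the anchor remains \<open>\<rho> j\<close>.\<close>
      have notQ: "\<rho> (j + i) \<notin> Q (\<rho> j)" for i
      proof (cases i)
        case 0
        then show ?thesis by (simp add: Q_def)
      next
        case (Suc i')
        show ?thesis
        proof
          assume "\<rho> (j + i) \<in> Q (\<rho> j)"
          then have "\<mu> (j + i) = \<rho> (j + i)"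
            using \<mu>[of "j + i'"] \<mu>_j[of i'] Suc by simp
          then have "\<rho> (j + i) = \<rho> j"
            using \<mu>_j[of i] by simp
          with \<open>\<rho> (j + i) \<in> Q (\<rho> j)\<close> show False
            by (simp add: Q_def)
        qed
      qed
      have "run_of (S (\<rho> j)) (\<rho> j) (\<lambda>i. \<rho> (j + i))"
        using \<rho>[of "j + _"] by (simp add: run_of_def \<mu>_j)
      then have "\<Phi> (\<rho> j) (\<lambda>i. \<rho> (j + i))"
        using S(2) j(2) by blast
      moreover have "f (\<rho> (j + i)) \<le> f (\<rho> j)" if "\<rho> (j + i) \<in> B" for i
        using notQ[of i] that by (simp add: Q_def)
      ultimately show ?thesis
        using j(2) by blast
    next
      case False
      have f_mono: "f (\<mu> i) \<le> f (\<mu> (i + n))" for i n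
      proof (induction n)
        case (Suc n)
        have "f (\<mu> (i + n)) \<le> f (\<mu> (i + Suc n))"
          using \<mu>[of "i + n"] by (simp add: Q_def)
        with Suc show ?case by simp
      qed simp
      \<comment> \<open>The equation \<open>\<mu> k = \<rho> k\<close> makes the next restart exceed
        \<open>f (\<rho> k)\<close>, so time and \<open>f\<close> both grow with
        \<open>n\<close>.\<close>
      have "\<exists>k\<ge>n. \<rho> k \<in> B \<and> n \<le> f (\<rho> k) \<and> \<mu> k = \<rho> k" for n
      proof (induction n)
        case 0
        obtain i where "\<rho> (Suc i) \<in> Q (\<mu> i)"
          using False by blast
        then show ?case
          using \<mu>[of i] by (intro exI[of _ "Suc i"]) (auto simp: Q_def)
      next
        case (Suc n)
        then obtain k where k: "n \<le> k" "n \<le> f (\<rho> k)" "\<mu> k = \<rho> k"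
          by blast
        obtain i where i: "k \<le> i" "\<rho> (Suc i) \<in> Q (\<mu> i)"
          using False by blast
        then show ?case
          using \<mu>[of i] k f_mono[of k "i - k"] by (intro exI[of _ "Suc i"]) (auto simp: Q_def)
      qed
      then show ?thesis
        by blast
    qed
  qed
qed

end

section \<open>Determinacy\<close>

text \<open>One-round determinacy: if \<open>A\<close> cannot force the next position into
  \<open>Z\<close>, then \<open>C\<close> can keep it out.\<close>

locale dual_arenas = C: arena C par len + A: arena A par len
  for C A :: "'p \<Rightarrow> 'p set set" and par :: "'p \<Rightarrow> 'p" and len :: "'p \<Rightarrow> nat" +
  assumes dual: "(\<exists>Y\<in>A p. Y \<subseteq> Z) \<or> (\<exists>X\<in>C p. X \<inter> Z = {})"
begin

text \<open>The region \<open>R\<close> from which the adversary can reach \<open>T\<close> contains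
  \<open>T\<close> and every position from which he can force entry into \<open>R\<close> in one
  move. By one-round determinacy the controller can then stay outside \<open>R\<close> forever; no
  transfinite attractor is built.\<close>

lemma reach_determined:
  "force A p (\<lambda>\<rho>. \<exists>k. \<rho> k \<in> T) \<or> force C p (\<lambda>\<rho>. \<forall>k. \<rho> k \<notin> T)"
proof (rule disjCI)
  define R where "R = {q. force A q (\<lambda>\<rho>. \<exists>k. \<rho> k \<in> T)}"
  assume "\<not> force C p (\<lambda>\<rho>. \<forall>k. \<rho> k \<notin> T)"
  have T: "q \<in> R" if "q \<in> T" for q
  proof -
    obtain Y where "Y \<in> A q"
      using A.E_nonempty[of q] by blast
    then obtain s where s: "\<forall>q. s q \<in> A q"
      using A.strategy_extending by blast
    have "\<exists>k. \<rho> k \<in> T" if "run_of s q \<rho>" for \<rho>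
      using that \<open>q \<in> T\<close> by (intro exI[of _ 0]) (simp add: run_of_def)
    with s show ?thesis
      unfolding R_def force_def by blast
  qed
  have step: "q \<in> R" if Y: "Y \<in> A q" "Y \<subseteq> R" for q Y
  proof -
    obtain s where s: "\<forall>q. s q \<in> A q" "s q = Y"
      using A.strategy_extending[OF Y(1)] by blast
    have "\<rho> 1 \<in> Y" if "run_of s q \<rho>" for \<rho>
      using that s(2) unfolding run_of_def by (metis One_nat_def)
    with s(1) have "force A q (\<lambda>\<rho>. \<rho> 1 \<in> Y)"
      unfolding force_def by blast
    then have "force A q (\<lambda>\<rho>. (\<rho> 1 \<in> Y \<and> (\<forall>k. \<rho> k \<notin> R)) \<or>
      (\<exists>k \<rho>'. \<rho> k \<in> R \<and> (\<exists>i. \<rho> (k + i) \<in> T) \<and> \<rho>' 1 \<in> Y \<and> (\<forall>i\<le>k. \<rho>' i = \<rho> i)))"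
      by (rule A.force_compose) (simp add: R_def)
    then have "force A q (\<lambda>\<rho>. \<exists>k. \<rho> k \<in> T)"
    proof (rule force_mono, elim disjE exE conjE)
      fix \<rho>
      assume "\<rho> 1 \<in> Y" "\<forall>k. \<rho> k \<notin> R"
      then show "\<exists>k. \<rho> k \<in> T"
        using Y(2) by blast
    qed blast
    then show ?thesis
      by (simp add: R_def)
  qed
  have "\<exists>X\<in>C q. q \<notin> R \<longrightarrow> X \<inter> R = {}" for q
    using dual[of q R] step C.E_nonempty[of q] by blast
  then obtain s where s: "\<And>q. s q \<in> C q" "\<And>q. q \<notin> R \<Longrightarrow> s q \<inter> R = {}"
    by metis
  have "\<rho> k \<notin> T" if run: "run_of s p \<rho>" and p: "p \<notin> R" for \<rho> k
  proof -
    have "\<rho> k \<notin> R"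
    proof (induction k)
      case 0
      then show ?case using run p by (simp add: run_of_def)
    next
      case (Suc k)
      have "\<rho> (Suc k) \<in> s (\<rho> k)"
        using run by (simp add: run_of_def)
      then show ?case using s(2)[OF Suc] by blast
    qed
    then show ?thesis
      using T by blast
  qed
  then have "p \<in> R"
    using s(1) \<open>\<not> force C p _\<close> unfolding force_def by blast
  then show "force A p (\<lambda>\<rho>. \<exists>k. \<rho> k \<in> T)"
    by (simp add: R_def)
qed

end


section \<open>Boundedness conditions and the escape game\<close>

definition nat_bounded :: "(nat \<Rightarrow> nat) \<Rightarrow> bool" where
  "nat_bounded g \<longleftrightarrow> (\<exists>M. \<forall>k. g k \<le> M)"

text \<open>The finitely many earlier values are absorbed into the bound. This carries guarantees
  about tails over to whole runs.\<close>

lemma nat_bounded_shift: "nat_bounded (\<lambda>i. g (k + i)) \<longleftrightarrow> nat_bounded g"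
proof
  assume "nat_bounded (\<lambda>i. g (k + i))"
  then obtain M where M: "\<And>i. g (k + i) \<le> M"
    unfolding nat_bounded_def by blast
  have "g i \<le> max M (Max (g ` {..k}))" for i
  proof (cases "i \<le> k")
    case True
    then show ?thesis by (simp add: le_max_iff_disj)
  next
    case False
    then show ?thesis using M[of "i - k"] by simp
  qed
  then show "nat_bounded g"
    unfolding nat_bounded_def by blast
qed (auto simp: nat_bounded_def)

locale escape_arena = dual_arenas C A par len
  for C A :: "'p \<Rightarrow> 'p set set" and par :: "'p \<Rightarrow> 'p" and len :: "'p \<Rightarrow> nat" +
  fixes e r :: "'p \<Rightarrow> nat"
  assumes e_mono_C: "X \<in> C p \<Longrightarrow> q \<in> X \<Longrightarrow> e p \<le> e q"
    and e_mono_A: "Y \<in> A p \<Longrightarrow> q \<in> Y \<Longrightarrow> e p \<le> e q"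
begin

lemma force_A_mono_e:
  assumes "force A p \<Phi>"
  shows "force A p (\<lambda>\<rho>. \<Phi> \<rho> \<and> (\<forall>i j. i \<le> j \<longrightarrow> e (\<rho> i) \<le> e (\<rho> j)))"
proof -
  obtain s where s: "\<forall>q. s q \<in> A q" "\<forall>\<rho>. run_of s p \<rho> \<longrightarrow> \<Phi> \<rho>"
    using assms unfolding force_def by blast
  have "e (\<rho> i) \<le> e (\<rho> j)" if "run_of s p \<rho>" "i \<le> j" for \<rho> i j
  proof (rule lift_Suc_mono_le[of "\<lambda>i. e (\<rho> i)", OF _ that(2)])
    show "e (\<rho> n) \<le> e (\<rho> (Suc n))" for n
      using that(1) s(1) e_mono_A[of "s (\<rho> n)"] by (simp add: run_of_def)
  qed
  with s show ?thesis
    unfolding force_def by blast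
qed

definition buechi :: "'p set \<Rightarrow> nat \<Rightarrow> (nat \<Rightarrow> 'p) \<Rightarrow> bool" where
  "buechi W M \<rho> \<longleftrightarrow> (\<exists>k. \<rho> k \<in> W) \<or> ((\<forall>k. e (\<rho> k) \<le> M) \<and> \<not> nat_bounded (\<lambda>k. r (\<rho> k)))"

text \<open>The threshold at \<open>q\<close> is \<open>r q\<close> itself. If from outside
  \<open>V\<close> the adversary could not force \<open>W\<close> or a position of \<open>B\<close>
  with larger \<open>r\<close>, the controller could avoid both until a possible entry into
  \<open>V\<close>, and so win.\<close>

lemma buechi_determined:
  "force A p (buechi W M) \<or> force C p (\<lambda>\<rho>. \<not> buechi W M \<rho>)"
proof (rule disjCI)
  define V where "V = {q. force C q (\<lambda>\<rho>. \<not> buechi W M \<rho>)}"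
  define B where "B = {q. q \<notin> V \<and> e q \<le> M}"
  assume "\<not> force C p (\<lambda>\<rho>. \<not> buechi W M \<rho>)"
  then have p: "p \<in> - V"
    by (simp add: V_def)
  have reach: "force A q (\<lambda>\<rho>. \<exists>k. \<rho> k \<in> W \<or> \<rho> k \<in> B \<and> r q < r (\<rho> k))" if "q \<in> - V" for q
  proof (rule ccontr)
    define T where "T = W \<union> {q' \<in> B. r q < r q'}"
    assume "\<not> ?thesis"
    then have "force C q (\<lambda>\<rho>. \<forall>k. \<rho> k \<notin> T)"
      using reach_determined[of q T] by (simp add: T_def)
    then have "force C q (\<lambda>\<rho>. ((\<forall>k. \<rho> k \<notin> T) \<and> (\<forall>k. \<rho> k \<notin> V)) \<or>
      (\<exists>k \<rho>'. \<rho> k \<in> V \<and> \<not> buechi W M (\<lambda>i. \<rho> (k + i)) \<and> (\<forall>k. \<rho>' k \<notin> T) \<and> (\<forall>i\<le>k. \<rho>' i = \<rho> i)))"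
      by (rule C.force_compose) (simp add: V_def)
    then have "force C q (\<lambda>\<rho>. \<not> buechi W M \<rho>)"
    proof (rule force_mono, elim disjE exE conjE)
      fix \<rho> :: "nat \<Rightarrow> 'p"
      assume "\<forall>k. \<rho> k \<notin> T" "\<forall>k. \<rho> k \<notin> V"
      \<comment> \<open>If \<open>e\<close> stays within \<open>M\<close>, every position lies in
        \<open>B\<close>, so \<open>r q\<close> bounds \<open>r\<close>.\<close>
      then have "\<rho> k \<notin> W" "e (\<rho> k) \<le> M \<Longrightarrow> r (\<rho> k) \<le> r q" for k
        by (auto simp: T_def B_def not_less)
      then show "\<not> buechi W M \<rho>"
        unfolding buechi_def nat_bounded_def by blast
    next
      fix \<rho> \<rho>' k
      assume tail: "\<not> buechi W M (\<lambda>i. \<rho> (k + i))"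
        and "\<forall>k. \<rho>' k \<notin> T" "\<forall>i\<le>k. \<rho>' i = \<rho> i"
      then have "\<rho> i \<notin> W" if "i \<le> k" for i
        using that unfolding T_def by (metis UnI1)
      moreover have "\<rho> i \<notin> W" if "k \<le> i" for i
        using tail that unfolding buechi_def by (metis le_add_diff_inverse)
      ultimately have "\<rho> i \<notin> W" for i
        using nat_le_linear by blast
      then show "\<not> buechi W M \<rho>"
        using tail nat_bounded_shift[of "\<lambda>i. r (\<rho> i)" k] unfolding buechi_def by blast
    qed
    then show False
      using that by (simp add: V_def)
  qed
  \<comment> \<open>In the first alternative the phase reaches \<open>W\<close> or raises
    \<open>r\<close> within \<open>B\<close>. The latter contradicts the bound by
    \<open>r (\<rho> k)\<close>, so \<open>W\<close> is reached.\<close>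
  have "force A p (\<lambda>\<rho>.
    ((\<exists>k. \<rho> k \<in> - V \<and> (\<exists>i. \<rho> (k + i) \<in> W \<or> \<rho> (k + i) \<in> B \<and> r (\<rho> k) < r (\<rho> (k + i))) \<and>
       (\<forall>i. \<rho> (k + i) \<in> B \<longrightarrow> r (\<rho> (k + i)) \<le> r (\<rho> k))) \<or>
     (\<forall>n. \<exists>k\<ge>n. \<rho> k \<in> B \<and> n \<le> r (\<rho> k))) \<and>
    (\<forall>i j. i \<le> j \<longrightarrow> e (\<rho> i) \<le> e (\<rho> j)))"
    by (rule force_A_mono_e, rule A.force_iterate[OF p reach]) (simp_all add: B_def)
  then show "force A p (buechi W M)"
  proof (rule force_mono, elim conjE disjE)
    fix \<rho>
    assume inf: "\<forall>n. \<exists>k\<ge>n. \<rho> k \<in> B \<and> n \<le> r (\<rho> k)"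
      and mono: "\<forall>i j. i \<le> j \<longrightarrow> e (\<rho> i) \<le> e (\<rho> j)"
    \<comment> \<open>\<open>B\<close> is visited arbitrarily late with \<open>e \<le> M\<close>,
      and monotonicity carries the bound back to time \<open>i\<close>.\<close>
    have "e (\<rho> i) \<le> M" for i
      using inf mono unfolding B_def by (metis (mono_tags, lifting) le_trans mem_Collect_eq)
    moreover have "\<not> nat_bounded (\<lambda>k. r (\<rho> k))"
      using inf unfolding nat_bounded_def by (meson Suc_n_not_le_n le_trans)
    ultimately show "buechi W M \<rho>"
      by (simp add: buechi_def)
  qed (fastforce simp: buechi_def not_less[symmetric])
qed

theorem escape_determined:
  defines "win \<equiv> \<lambda>\<rho>. nat_bounded (\<lambda>k. e (\<rho> k)) \<and> \<not> nat_bounded (\<lambda>k. r (\<rho> k))"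
  shows "force A p win \<or> force C p (\<lambda>\<rho>. \<not> win \<rho>)"
proof (cases "force A p win")
  case False
  define W where "W = {q. force A q win}"
  have p: "p \<in> - W"
    using False by (simp add: W_def)
  \<comment> \<open>Otherwise the adversary forces \<open>buechi\<close> from \<open>q\<close>.
    Without a visit to \<open>W\<close> this gives \<open>win\<close> directly; after a visit his
    strategy from there does. Hence \<open>q\<close> would lie in \<open>W\<close>.\<close>
  have phase: "force C q (\<lambda>\<rho>. \<not> buechi W (e q) \<rho>)" if "q \<in> - W" for q
  proof (rule ccontr)
    assume "\<not> ?thesis"
    then have "force A q (buechi W (e q))"
      using buechi_determined by blast
    then have "force A q (\<lambda>\<rho>. (buechi W (e q) \<rho> \<and> (\<forall>k. \<rho> k \<notin> W)) \<or>
      (\<exists>k \<rho>'. \<rho> k \<in> W \<and> win (\<lambda>i. \<rho> (k + i)) \<and> buechi W (e q) \<rho>' \<and> (\<forall>i\<le>k. \<rho>' i = \<rho> i)))"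
      by (rule A.force_compose) (simp add: W_def)
    then have "force A q win"
    proof (rule force_mono, elim disjE exE conjE)
      fix \<rho>
      assume "buechi W (e q) \<rho>" "\<forall>k. \<rho> k \<notin> W"
      then show "win \<rho>"
        unfolding buechi_def win_def nat_bounded_def[of "\<lambda>k. e (\<rho> k)"] by blast
    next
      fix \<rho> k
      assume "win (\<lambda>i. \<rho> (k + i))"
      then show "win \<rho>"
        using nat_bounded_shift[of "\<lambda>i. e (\<rho> i)" k] nat_bounded_shift[of "\<lambda>i. r (\<rho> i)" k]
        by (simp add: win_def)
    qed
    then show False
      using that by (simp add: W_def)
  qed
  \<comment> \<open>With \<open>B = UNIV\<close> and \<open>f = e\<close>, every increase of
    \<open>e\<close> above its value at the anchor is a restart. The new anchor is outside
    \<open>W\<close> because failure of \<open>buechi\<close> includes avoiding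
    \<open>W\<close>.\<close>
  have "force C p (\<lambda>\<rho>.
    (\<exists>k. \<rho> k \<in> - W \<and> \<not> buechi W (e (\<rho> k)) (\<lambda>i. \<rho> (k + i)) \<and>
       (\<forall>i. \<rho> (k + i) \<in> UNIV \<longrightarrow> e (\<rho> (k + i)) \<le> e (\<rho> k))) \<or>
    (\<forall>n. \<exists>k\<ge>n. \<rho> k \<in> UNIV \<and> n \<le> e (\<rho> k)))"
    by (rule C.force_iterate[OF p phase]) (auto simp: buechi_def)
  then have "force C p (\<lambda>\<rho>. \<not> win \<rho>)"
  proof (rule force_mono, elim disjE exE conjE)
    fix \<rho> k
    assume "\<not> buechi W (e (\<rho> k)) (\<lambda>i. \<rho> (k + i))"
      "\<forall>i. \<rho> (k + i) \<in> UNIV \<longrightarrow> e (\<rho> (k + i)) \<le> e (\<rho> k)"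
    then have "nat_bounded (\<lambda>i. r (\<rho> (k + i)))"
      by (simp add: buechi_def)
    then show "\<not> win \<rho>"
      using nat_bounded_shift[of "\<lambda>i. r (\<rho> i)" k] by (simp add: win_def)
  next
    fix \<rho>
    assume "\<forall>n. \<exists>k\<ge>n. \<rho> k \<in> UNIV \<and> n \<le> e (\<rho> k)"
    then show "\<not> win \<rho>"
      unfolding win_def nat_bounded_def by (meson Suc_n_not_le_n le_trans)
  qed
  then show ?thesis ..
qed simp

end

section \<open>Response histories\<close>

lemma history_eqI:
  "states H = states H' \<Longrightarrow> responses H = responses H' \<Longrightarrow> H = H'"
  by transfer auto

lemma succ_history_inject:
  "succ_history H u r = succ_history H' u' r' \<Longrightarrow> H = H'"
  by (metis append1_eq_conv history_eqI responses_succ_history states_succ_history)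

lemma hlen_succ_history: "hlen (succ_history H u r) = Suc (hlen H)"
  by (simp add: hlen_def responses_succ_history)

lemma Env_nonneg: "0 \<le> Env l H"
proof (cases "hlen H = 0")
  case False
  then have "(0, 0) \<in> {0..<hlen H} \<times> {0..<hlen H}"
    by simp
  then show ?thesis
    using False unfolding Env_def
    by (auto intro!: Max_ge_iff[THEN iffD2] bexI[of _ "(0, 0)"])
qed (simp add: Env_def)

text \<open>Old states and responses keep their indices, so the maximum for \<open>H\<close> ranges
  over a subset of the successor's terms.\<close>

lemma Env_mono: "Env l H \<le> Env l (succ_history H u r)"
proof (cases "hlen H = 0")
  case True
  then have "Env l H = 0"
    by (simp add: Env_def)
  then show ?thesis
    using Env_nonneg by metis
next
  case False
  define t where "t G = (\<lambda>(i, j). max (norm (responses G ! i - responses G ! j)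
    - l * norm (states G ! i - states G ! j)) 0)" for G :: "'a history"
  let ?G = "succ_history H u r"
  have "t H ` ({0..<hlen H} \<times> {0..<hlen H}) = t ?G ` ({0..<hlen H} \<times> {0..<hlen H})"
    by (rule image_cong)
      (auto simp: t_def states_succ_history responses_succ_history nth_append length_states
        hlen_def[symmetric])
  also have "\<dots> \<subseteq> t ?G ` ({0..<hlen ?G} \<times> {0..<hlen ?G})"
    by (rule image_mono) (auto simp: hlen_succ_history)
  finally have "Max (t H ` ({0..<hlen H} \<times> {0..<hlen H}))
      \<le> Max (t ?G ` ({0..<hlen ?G} \<times> {0..<hlen ?G}))"
    by (rule Max_mono) (use False in auto)
  then show ?thesis
    using False by (simp add: Env_def t_def hlen_succ_history)
qed

section \<open>The tree of histories as an arena\<close>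

definition controller_moves :: "'d::finite history \<Rightarrow> 'd history set set" where
  "controller_moves H = range (\<lambda>u. range (succ_history H u))"

text \<open>The adversary sees \<open>u\<close> before answering, so his choice in a round is a
  whole response function \<open>f\<close>.\<close>

definition adversary_moves :: "'d::finite history \<Rightarrow> 'd history set set" where
  "adversary_moves H = range (\<lambda>f. range (\<lambda>u. succ_history H u (f u)))"

definition parent :: "'d::finite history \<Rightarrow> 'd history" where
  "parent G = (THE H. \<exists>u r. G = succ_history H u r)"

lemma parent_succ_history: "parent (succ_history H u r) = H"
  unfolding parent_def by (rule the_equality) (auto dest: succ_history_inject)

interpretation history_game: escape_arena controller_moves adversary_moves parent hlen
  "\<lambda>H. nat \<lfloor>Env l H\<rfloor>" "\<lambda>H. nat \<lfloor>rad H\<rfloor>" for l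
proof unfold_locales
  fix p :: "'d::finite history" and Z
  show "(\<exists>Y\<in>adversary_moves p. Y \<subseteq> Z) \<or> (\<exists>X\<in>controller_moves p. X \<inter> Z = {})"
  proof (cases "\<forall>u. \<exists>r. succ_history p u r \<in> Z")
    case True
    then obtain f where "\<And>u. succ_history p u (f u) \<in> Z"
      by metis
    then show ?thesis
      unfolding adversary_moves_def by blast
  next
    case False
    then show ?thesis
      unfolding controller_moves_def by blast
  qed
qed (auto simp: controller_moves_def adversary_moves_def parent_succ_history hlen_succ_history
    intro!: nat_mono floor_mono Env_mono)

text \<open>Rounding down loses less than 1, and truncating negative values to 0 does not affect
  boundedness above.\<close>

lemma SUP_ereal_less_top_iff:
  fixes g :: "nat \<Rightarrow> real"
  shows "(SUP k. ereal (g k)) < \<infinity> \<longleftrightarrow> nat_bounded (\<lambda>k. nat \<lfloor>g k\<rfloor>)"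
proof
  assume less: "(SUP k. ereal (g k)) < \<infinity>"
  obtain c :: nat where "(SUP k. ereal (g k)) \<le> ereal (real c)"
    using less less_PInf_Ex_of_nat[of "SUP k. ereal (g k)"] by (auto dest: less_imp_le)
  then have "g k \<le> real c" for k
    by (simp add: SUP_le_iff)
  then have "nat \<lfloor>g k\<rfloor> \<le> c" for k
    by (metis floor_mono floor_of_nat nat_int nat_mono)
  then show "nat_bounded (\<lambda>k. nat \<lfloor>g k\<rfloor>)"
    unfolding nat_bounded_def by blast
next
  assume "nat_bounded (\<lambda>k. nat \<lfloor>g k\<rfloor>)"
  then obtain M where M: "\<And>k. nat \<lfloor>g k\<rfloor> \<le> M"
    unfolding nat_bounded_def by blast
  have "g k \<le> real M + 1" for k
    using M[of k] by linarith
  then have "(SUP k. ereal (g k)) \<le> ereal (real M + 1)"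
    by (simp add: SUP_le_iff)
  then show "(SUP k. ereal (g k)) < \<infinity>"
    by (rule le_less_trans) simp
qed

lemma Esc_iff:
  assumes "\<pi> \<in> plays H0"
  shows "\<pi> \<in> Esc l H0 \<longleftrightarrow> nat_bounded (\<lambda>k. nat \<lfloor>Env l (hist \<pi> k)\<rfloor>) \<and>
    \<not> nat_bounded (\<lambda>k. nat \<lfloor>rad (hist \<pi> k)\<rfloor>)"
  using assms SUP_ereal_less_top_iff[of "\<lambda>k. Env l (hist \<pi> k)"]
    SUP_ereal_less_top_iff[of "\<lambda>k. rad (hist \<pi> k)"]
  by (auto simp: Esc_def Env_inf_def)

section \<open>From forcing to strategies and plays\<close>

lemma hist_play_of_0: "hist (play_of \<mu> \<sigma> H0) 0 = H0"
  by (simp add: hist_def Let_def)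

lemma hist_play_of_Suc:
  "hist (play_of \<mu> \<sigma> H0) (Suc k) = succ_history (hist (play_of \<mu> \<sigma> H0) k)
     (\<mu> (hist (play_of \<mu> \<sigma> H0) k)) (\<sigma> (hist (play_of \<mu> \<sigma> H0) k, \<mu> (hist (play_of \<mu> \<sigma> H0) k)))"
  by (cases k) (simp_all add: hist_def Let_def)

text \<open>Choosing a response function for the move set at each history yields
  \<open>\<sigma>\<close>, and every play against it is a run of \<open>s\<close>.\<close>

lemma adversary_wins_if_force:
  assumes "force adversary_moves H0 \<Phi>" and "\<And>\<pi>. \<pi> \<in> plays H0 \<Longrightarrow> \<Phi> (hist \<pi>) \<Longrightarrow> \<pi> \<in> W"
  shows "adversary_wins H0 W"
proof -
  obtain s where s: "\<forall>H. s H \<in> adversary_moves H" "\<forall>\<rho>. run_of s H0 \<rho> \<longrightarrow> \<Phi> \<rho>"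
    using assms(1) unfolding force_def by blast
  obtain f where f: "\<And>H. s H = range (\<lambda>u. succ_history H u (f H u))"
    using s(1) unfolding adversary_moves_def image_def by simp metis
  have "run_of s H0 (hist (play_of \<mu> (\<lambda>(H, u). f H u) H0))" for \<mu>
    by (simp add: run_of_def f hist_play_of_0 hist_play_of_Suc)
  then show ?thesis
    unfolding adversary_wins_def using s(2) assms(2) play_of_in_plays by blast
qed

lemma controller_wins_if_force:
  assumes "force controller_moves H0 \<Phi>" and "\<And>\<pi>. \<pi> \<in> plays H0 \<Longrightarrow> \<Phi> (hist \<pi>) \<Longrightarrow> \<pi> \<notin> W"
  shows "controller_wins H0 W"
proof -
  obtain s where s: "\<forall>H. s H \<in> controller_moves H" "\<forall>\<rho>. run_of s H0 \<rho> \<longrightarrow> \<Phi> \<rho>"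
    using assms(1) unfolding force_def by blast
  obtain \<mu> where \<mu>: "\<And>H. s H = range (succ_history H (\<mu> H))"
    using s(1) unfolding controller_moves_def image_def by simp metis
  have "run_of s H0 (hist (play_of \<mu> \<sigma> H0))" for \<sigma>
    by (simp add: run_of_def \<mu> hist_play_of_0 hist_play_of_Suc)
  then show ?thesis
    unfolding controller_wins_def using s(2) assms(2) play_of_in_plays by blast
qed

theorem proposition3p4:
  fixes H0 :: "'d::finite history" and l :: real
  assumes "l \<ge> 0"
  shows "(adversary_wins H0 (Esc l H0) \<or> controller_wins H0 (Esc l H0)) \<and>
         \<not> (adversary_wins H0 (Esc l H0) \<and> controller_wins H0 (Esc l H0))"
proof
  show "adversary_wins H0 (Esc l H0) \<or> controller_wins H0 (Esc l H0)"
    using history_game.escape_determined[of H0 l]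
  proof
    assume "force adversary_moves H0 (\<lambda>\<rho>. nat_bounded (\<lambda>k. nat \<lfloor>Env l (\<rho> k)\<rfloor>) \<and>
      \<not> nat_bounded (\<lambda>k. nat \<lfloor>rad (\<rho> k)\<rfloor>))"
    then have "adversary_wins H0 (Esc l H0)"
      by (rule adversary_wins_if_force) (simp add: Esc_iff)
    then show ?thesis ..
  next
    assume "force controller_moves H0 (\<lambda>\<rho>. \<not> (nat_bounded (\<lambda>k. nat \<lfloor>Env l (\<rho> k)\<rfloor>) \<and>
      \<not> nat_bounded (\<lambda>k. nat \<lfloor>rad (\<rho> k)\<rfloor>)))"
    then have "controller_wins H0 (Esc l H0)"
      by (rule controller_wins_if_force) (simp add: Esc_iff)
    then show ?thesis ..
  qed
  \<comment> \<open>Two winning strategies played against each other would give a play both in and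
    outside \<open>Esc l H0\<close>.\<close>
  show "\<not> (adversary_wins H0 (Esc l H0) \<and> controller_wins H0 (Esc l H0))"
    unfolding adversary_wins_def controller_wins_def by blast
qed

end
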